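(* For every epoch $t\in\{0,\dots,T\}$ and every leader information history $\zeta_t^L$ with current leader state $s_t^L$ and belief $x_t^L=\{P(s_t^F\mid \zeta_t^L)\}_{s_t^F\in S^F}$, $$v_t^L(\zeta_t^L)=v_t^L(s_t^L,x_t^L)=[Hv_{t+1}^L](s_t^L,x_t^L).$$ Thus $v_t^L$ depends on $\zeta_t^L$ only through $(s_t^L,x_t^L)$, i.e. $(s_t^L,x_t^L)$ is a sufficient statistic for $v_t^L$. Furthermore, if $v\in V$ is piecewise linear in $x^L$ (for each $s^L\in S^L$), then $Hv$ is also piecewise linear in $x^L$ (for each $s^L\in S^L$).
   Context: Leader–follower partially observable game, seen from the leader. $S^L,S^F,A^L,A^F,Z^L$ are finite nonempty sets (leader states, follower states, leader actions, follower actions, leader observations); $s=(s^L,s^F)$, $a=(a^L,a^F)$. $r^L(s,a)\in\mathbb{R}$ is the leader's reward, $P(z^{L'},s'\mid s,a)$ is a given conditional probability of the next observation $z^{L'}\in Z^L$ and next state pair $s'=(s^{L'},s^{F'})$ given $s,a$, and $\beta\ge 0$ is a discount factor. The horizon $T$ is finite. The leader's information history is $\zeta_t^L=\{s_t^L,\dots,s_0^L,z_t^L,\dots,z_1^L,a_{t-1},\dots,a_0,x_0^L\}$, where $x_0^L$ is a prior probability vector on $S^F$; $\zeta_{t+1}^L=\{z_{t+1}^L,s_{t+1}^L,a_t,\zeta_t^L\}$. The leader's worst-case value function is defined by $v_{T+1}^L\equiv 0$ and, for $t\le T$, $$v_t^L(\zeta_t^L)=\max_{a_t^L\in A^L}\min_{a_t^F\in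 A^F}\Big\{\sum_{s_t^F}r^L(s_t,a_t)P(s_t^F\mid\zeta_t^L)+\beta\sum_{z_{t+1}^L}\sum_{s_{t+1}^L}P(z_{t+1}^L,s_{t+1}^L\mid\zeta_t^L,a_t)\,v_{t+1}^L(\zeta_{t+1}^L)\Big\}.$$ Let $X^L$ be the set of probability vectors on $S^F$, and for $x^L\in X^L$, $\gamma\in\mathbb{R}^{S^F}$ write $x^L\gamma=\sum_{s^F}x^L(s^F)\gamma(s^F)$ and $x^Lr^L(s^L,a)=\sum_{s^F}x^L(s^F)r^L(s^L,s^F,a)$. Put $$\sigma^L(z^{L'},s^{L'},s^L,x^L,a)=\sum_{s^{F'}}\sum_{s^F}P(z^{L'},s'\mid s,a)x^L(s^F),$$ and, when this is non-zero, let $\lambda^L(z^{L'},s^{L'},s^L,x^L,a)\in X^L$ be the vector with entries $$s^{F'}\mapsto \frac{\sum_{s^F}P(z^{L'},s'\mid s,a)x^L(s^F)}{\sigma^L(z^{L'},s^{L'},s^L,x^L,a)}.$$ The beliefs are updated by Bayes' rule, $x_{t+1}^L=\lambda^L(z_{t+1}^L,s_{t+1}^L,s_t^L,x_t^L,a_t)$, and $P(z_{t+1}^L,s_{t+1}^L\mid a_t,\zeta_t^L)=\sigma^L(z_{t+1}^L,s_{t+1}^L,s_t^L,x_t^L,a_t)$. Histories are those for which all the normalizing quantities $\sigma^L$ along the history are non-zero; terms with $\sigma^L=0$ in sums are read as $0$. $V$ is the Banach space of bounded real-valued functions on $S^L\times X^L$ with the supremum norm, and $H:V\to V$ is $$[Hv](s^L,x^L)=\max_{a^L\in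 A^L}\min_{a^F\in A^F}\Big\{x^Lr^L(s^L,a)+\beta\sum_{z^{L'}}\sum_{s^{L'}}\sigma^L(z^{L'},s^{L'},s^L,x^L,a)\,v\big(s^{L'},\lambda^L(z^{L'},s^{L'},s^L,x^L,a)\big)\Big\}.$$ A function $f(s^L,\cdot)$, for fixed $s^L$, is called piecewise linear on $X^L$ if there is a finite set $\Gamma(s^L)\subset\mathbb{R}^{S^F}$ such that for every $x^L\in X^L$ there is $\gamma\in\Gamma(s^L)$ with $f(s^L,x^L)=x^L\gamma$. *)

theory Defs
  imports "HOL-Probability.Probability"
begin

text \<open>
  A state is a pair (leader state, follower state) and an action a pair
  (leader action, follower action); all five ground sets are types of class \<^class>\<open>finite\<close>.
  The kernel \<open>K s a\<close> is the conditional law \<open>P(z', s' | s, a)\<close> of the next leader observation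
  and the next state.  The set \<open>X\<^sup>L\<close> of probability vectors on the follower states is the type
  \<^typ>\<open>'sf pmf\<close>.
\<close>

type_synonym ('sl, 'sf, 'al, 'af, 'zl) kernel =
  "'sl \<times> 'sf \<Rightarrow> 'al \<times> 'af \<Rightarrow> ('zl \<times> 'sl \<times> 'sf) pmf"

type_synonym ('sl, 'sf, 'al, 'af) reward = "'sl \<times> 'sf \<Rightarrow> 'al \<times> 'af \<Rightarrow> real"

text \<open>
  Information histories of the leader: \<open>Start s\<^sub>0 x\<^sub>0\<close> is the history at epoch 0, and
  \<open>Step z s a \<zeta>\<close> prolongs \<open>\<zeta>\<close> by the last action pair, the new leader state and the new observation.
\<close>

datatype ('sl, 'sf, 'al, 'af, 'zl) history =
  Start (leader: 'sl) (prior: "'sf pmf")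
| Step (obs: 'zl) (leader: 'sl) (act: "'al \<times> 'af") (past: "('sl, 'sf, 'al, 'af, 'zl) history")

primrec epoch :: "('sl, 'sf, 'al, 'af, 'zl) history \<Rightarrow> nat" where
  "epoch (Start s x) = 0"
| "epoch (Step z s a \<zeta>) = Suc (epoch \<zeta>)"

primrec init_leader :: "('sl, 'sf, 'al, 'af, 'zl) history \<Rightarrow> 'sl" where
  "init_leader (Start s x) = s"
| "init_leader (Step z s a \<zeta>) = init_leader \<zeta>"

primrec init_prior :: "('sl, 'sf, 'al, 'af, 'zl) history \<Rightarrow> 'sf pmf" where
  "init_prior (Start s x) = x"
| "init_prior (Step z s a \<zeta>) = init_prior \<zeta>"

primrec acts :: "('sl, 'sf, 'al, 'af, 'zl) history \<Rightarrow> ('al \<times> 'af) list" where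
  "acts (Start s x) = []"
| "acts (Step z s a \<zeta>) = a # acts \<zeta>"

text \<open>
  Joint law of \<open>(\<zeta>\<^sub>t, s\<^sub>t\<^sup>F)\<close> when the game starts in leader state \<open>s\<^sub>0\<close> with prior \<open>x\<^sub>0\<close> and the
  given action pairs (latest first) are played.
\<close>

primrec law :: "('sl, 'sf, 'al, 'af, 'zl) kernel \<Rightarrow> 'sl \<Rightarrow> 'sf pmf \<Rightarrow> ('al \<times> 'af) list
    \<Rightarrow> (('sl, 'sf, 'al, 'af, 'zl) history \<times> 'sf) pmf" where
  "law K s\<^sub>0 x\<^sub>0 [] = map_pmf (\<lambda>y. (Start s\<^sub>0 x\<^sub>0, y)) x\<^sub>0"
| "law K s\<^sub>0 x\<^sub>0 (a # as) =
     bind_pmf (law K s\<^sub>0 x\<^sub>0 as)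
       (\<lambda>(\<zeta>, y). map_pmf (\<lambda>(z, s', y'). (Step z s' a \<zeta>, y')) (K (leader \<zeta>, y) a))"

text \<open>\<open>P(s\<^sub>t\<^sup>F | \<zeta>\<^sub>t)\<close>:\<close>

definition follower_prob ::
  "('sl, 'sf, 'al, 'af, 'zl) kernel \<Rightarrow> ('sl, 'sf, 'al, 'af, 'zl) history \<Rightarrow> 'sf \<Rightarrow> real" where
  "follower_prob K \<zeta> y =
     \<P>(\<omega> in law K (init_leader \<zeta>) (init_prior \<zeta>) (acts \<zeta>). snd \<omega> = y \<bar> fst \<omega> = \<zeta>)"

text \<open>\<open>P(z\<^sub>t\<^sub>+\<^sub>1\<^sup>L, s\<^sub>t\<^sub>+\<^sub>1\<^sup>L | \<zeta>\<^sub>t, a\<^sub>t)\<close>:\<close>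

definition next_prob ::
  "('sl, 'sf, 'al, 'af, 'zl) kernel \<Rightarrow> ('sl, 'sf, 'al, 'af, 'zl) history \<Rightarrow> 'al \<times> 'af
     \<Rightarrow> 'zl \<Rightarrow> 'sl \<Rightarrow> real" where
  "next_prob K \<zeta> a z s' =
     \<P>(\<omega> in law K (init_leader \<zeta>) (init_prior \<zeta>) (a # acts \<zeta>).
        obs (fst \<omega>) = z \<and> leader (fst \<omega>) = s' \<bar> past (fst \<omega>) = \<zeta>)"

definition belief ::
  "('sl, 'sf, 'al, 'af, 'zl) kernel \<Rightarrow> ('sl, 'sf, 'al, 'af, 'zl) history \<Rightarrow> 'sf pmf" where
  "belief K \<zeta> = embed_pmf (follower_prob K \<zeta>)"

definition sigma :: "('sl, 'sf::finite, 'al, 'af, 'zl) kernel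
    \<Rightarrow> 'zl \<Rightarrow> 'sl \<Rightarrow> 'sl \<Rightarrow> 'sf pmf \<Rightarrow> 'al \<times> 'af \<Rightarrow> real" where
  "sigma K z s' s x a = (\<Sum>y'\<in>UNIV. \<Sum>y\<in>UNIV. pmf (K (s, y) a) (z, s', y') * pmf x y)"

text \<open>
  When \<open>sigma\<close> vanishes, \<open>bayes\<close> is an unspecified probability vector; it then only ever occurs
  with the factor \<open>sigma = 0\<close>.
\<close>

definition bayes :: "('sl, 'sf::finite, 'al, 'af, 'zl) kernel
    \<Rightarrow> 'zl \<Rightarrow> 'sl \<Rightarrow> 'sl \<Rightarrow> 'sf pmf \<Rightarrow> 'al \<times> 'af \<Rightarrow> 'sf pmf" where
  "bayes K z s' s x a =
     embed_pmf (\<lambda>y'. (\<Sum>y\<in>UNIV. pmf (K (s, y) a) (z, s', y') * pmf x y) / sigma K z s' s x a)"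

primrec admissible :: "('sl, 'sf::finite, 'al, 'af, 'zl) kernel
    \<Rightarrow> ('sl, 'sf, 'al, 'af, 'zl) history \<Rightarrow> bool" where
  "admissible K (Start s x) \<longleftrightarrow> True"
| "admissible K (Step z s a \<zeta>) \<longleftrightarrow>
     admissible K \<zeta> \<and> sigma K z s (leader \<zeta>) (belief K \<zeta>) a \<noteq> 0"

function worst_case_value :: "('sl::finite, 'sf::finite, 'al::finite, 'af::finite, 'zl::finite) kernel
    \<Rightarrow> ('sl, 'sf, 'al, 'af) reward \<Rightarrow> real \<Rightarrow> nat \<Rightarrow> nat
    \<Rightarrow> ('sl, 'sf, 'al, 'af, 'zl) history \<Rightarrow> real" where
  "worst_case_value K r \<beta> T t \<zeta> =
     (if t > T then 0 else
        (MAX aL. MIN aF.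
           (\<Sum>y\<in>UNIV. r (leader \<zeta>, y) (aL, aF) * follower_prob K \<zeta> y)
           + \<beta> * (\<Sum>z\<in>UNIV. \<Sum>s'\<in>UNIV.
                  next_prob K \<zeta> (aL, aF) z s'
                  * worst_case_value K r \<beta> T (Suc t) (Step z s' (aL, aF) \<zeta>))))"
  by pat_completeness auto
termination
  by (relation "Wellfounded.measure (\<lambda>(K, r, \<beta>, T, t, \<zeta>). Suc T - t)") auto

declare worst_case_value.simps [simp del]

definition V :: "('sl \<times> 'sf pmf \<Rightarrow> real) set" where
  "V = {v. bounded (range v)}"

definition H :: "('sl::finite, 'sf::finite, 'al::finite, 'af::finite, 'zl::finite) kernel
    \<Rightarrow> ('sl, 'sf, 'al, 'af) reward \<Rightarrow> real
    \<Rightarrow> ('sl \<times> 'sf pmf \<Rightarrow> real) \<Rightarrow> 'sl \<times> 'sf pmf \<Rightarrow> real" where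
  "H K r \<beta> v = (\<lambda>(s, x).
     MAX aL. MIN aF.
       (\<Sum>y\<in>UNIV. pmf x y * r (s, y) (aL, aF))
       + \<beta> * (\<Sum>z\<in>UNIV. \<Sum>s'\<in>UNIV.
              sigma K z s' s x (aL, aF) * v (s', bayes K z s' s x (aL, aF))))"

definition piecewise_linear :: "('sf::finite pmf \<Rightarrow> real) \<Rightarrow> bool" where
  "piecewise_linear f \<longleftrightarrow>
     (\<exists>\<Gamma> :: ('sf \<Rightarrow> real) set. finite \<Gamma> \<and> (\<forall>x. \<exists>\<gamma>\<in>\<Gamma>. f x = (\<Sum>y\<in>UNIV. pmf x y * \<gamma> y)))"

text \<open>
  The conditional probabilities defined above satisfy Bayes' rule.
\<close>

lemma pmf_embed_pmf_finite:
  fixes f :: "'sf::finite \<Rightarrow> real"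
  assumes "\<And>y. 0 \<le> f y" "sum f UNIV = 1"
  shows "pmf (embed_pmf f) y = f y"
proof (rule pmf_embed_pmf)
  show "(\<integral>\<^sup>+x. ennreal (f x) \<partial>count_space UNIV) = 1"
    using assms by (simp add: nn_integral_count_space_finite sum_ennreal)
qed (use assms in auto)

abbreviation weight where
  "weight K \<zeta> y \<equiv> pmf (law K (init_leader \<zeta>) (init_prior \<zeta>) (acts \<zeta>)) (\<zeta>, y)"

lemma weight_Start: "weight K (Start s x) y = pmf x y"
proof -
  have "inj (\<lambda>y. (Start s x, y))" by (auto simp: inj_on_def)
  from pmf_map_inj'[OF this] show ?thesis by simp
qed

lemma weight_Step:
  fixes K :: "('sl, 'sf::finite, 'al, 'af, 'zl) kernel"
  shows "weight K (Step z s a \<zeta>) y' =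
    (\<Sum>y\<in>UNIV. pmf (K (leader \<zeta>, y) a) (z, s, y') * weight K \<zeta> y)"
proof -
  let ?L = "law K (init_leader \<zeta>) (init_prior \<zeta>) (acts \<zeta>)"
  let ?g = "\<lambda>\<eta> :: ('sl, 'sf, 'al, 'af, 'zl) history. \<lambda>(z, s', y'). (Step z s' a \<eta>, y' :: 'sf)"
  have inj: "inj (?g \<eta>)" for \<eta>
    by (auto simp: inj_on_def)
  have same: "pmf (map_pmf (?g \<zeta>) q) (Step z s a \<zeta>, y') = pmf q (z, s, y')" for q
    using pmf_map_inj'[OF inj, of \<zeta> q "(z, s, y')"] by simp
  have other: "pmf (map_pmf (?g \<eta>) q) (Step z s a \<zeta>, y') = 0" if "\<eta> \<noteq> \<zeta>" for \<eta> q
    using that by (auto simp: pmf_eq_0_set_pmf)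
  have "weight K (Step z s a \<zeta>) y' =
      (\<integral>\<omega>. pmf (map_pmf (?g (fst \<omega>)) (K (leader (fst \<omega>), snd \<omega>) a)) (Step z s a \<zeta>, y') \<partial>?L)"
    by (simp add: pmf_bind case_prod_unfold)
  also have "\<dots> = (\<Sum>\<omega>\<in>{\<zeta>} \<times> UNIV. pmf ?L \<omega> *\<^sub>R
      pmf (map_pmf (?g (fst \<omega>)) (K (leader (fst \<omega>), snd \<omega>) a)) (Step z s a \<zeta>, y'))"
    by (rule integral_measure_pmf) (use other in \<open>auto, metis\<close>)
  also have "\<dots> = (\<Sum>y\<in>UNIV. pmf ?L (\<zeta>, y) * pmf (K (leader \<zeta>, y) a) (z, s, y'))"
  proof -
    have "{\<zeta>} \<times> (UNIV :: 'sf set) = Pair \<zeta> ` UNIV" by auto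
    then show ?thesis
      by (simp add: sum.reindex inj_on_def same)
  qed
  finally show ?thesis by (simp add: mult.commute)
qed

abbreviation total_weight where
  "total_weight K \<zeta> \<equiv> \<Sum>y\<in>UNIV. weight K \<zeta> y"

lemma prob_history:
  fixes \<zeta> :: "('sl, 'sf::finite, 'al, 'af, 'zl) history"
  shows "\<P>(\<omega> in law K (init_leader \<zeta>) (init_prior \<zeta>) (acts \<zeta>). fst \<omega> = \<zeta>) = total_weight K \<zeta>"
proof -
  have eq: "{\<omega>. fst \<omega> = \<zeta>} = Pair \<zeta> ` (UNIV :: 'sf set)" by auto
  show ?thesis
    by (simp add: eq measure_measure_pmf_finite sum.reindex inj_on_def)
qed

lemma follower_prob_eq:
  fixes \<zeta> :: "('sl, 'sf::finite, 'al, 'af, 'zl) history"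
  shows "follower_prob K \<zeta> y = weight K \<zeta> y / total_weight K \<zeta>"
proof -
  have "{\<omega>. snd \<omega> = y \<and> fst \<omega> = \<zeta>} = {(\<zeta>, y)}" by auto
  then show ?thesis
    using prob_history[of K \<zeta>]
    by (simp add: follower_prob_def cond_prob_def measure_pmf_single)
qed

lemma pmf_belief_aux:
  fixes \<zeta> :: "('sl, 'sf::finite, 'al, 'af, 'zl) history"
  assumes "total_weight K \<zeta> \<noteq> 0"
  shows "pmf (belief K \<zeta>) y = follower_prob K \<zeta> y"
  unfolding belief_def
  by (rule pmf_embed_pmf_finite)
    (use assms in \<open>auto simp: follower_prob_eq sum_nonneg simp flip: sum_divide_distrib\<close>)

lemma sum_weight_Step:
  fixes \<zeta> :: "('sl, 'sf::finite, 'al, 'af, 'zl) history"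
  assumes "total_weight K \<zeta> \<noteq> 0"
  shows "weight K (Step z s a \<zeta>) y' = total_weight K \<zeta> *
    (\<Sum>y\<in>UNIV. pmf (K (leader \<zeta>, y) a) (z, s, y') * pmf (belief K \<zeta>) y)"
  using assms
  by (simp add: weight_Step pmf_belief_aux follower_prob_eq sum_distrib_left del: law.simps
        init_leader.simps init_prior.simps acts.simps)

lemma total_weight_Step:
  fixes \<zeta> :: "('sl, 'sf::finite, 'al, 'af, 'zl) history"
  assumes "total_weight K \<zeta> \<noteq> 0"
  shows "total_weight K (Step z s a \<zeta>)
    = total_weight K \<zeta> * sigma K z s (leader \<zeta>) (belief K \<zeta>) a"
  unfolding sum_weight_Step[OF assms] sigma_def by (simp add: sum_distrib_left)

lemma admissible_total_weight:
  fixes \<zeta> :: "('sl, 'sf::finite, 'al, 'af, 'zl) history"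
  shows "admissible K \<zeta> \<Longrightarrow> total_weight K \<zeta> \<noteq> 0"
proof (induction \<zeta>)
  case (Start s x)
  show ?case unfolding weight_Start using sum_pmf_eq_1[of UNIV x] by simp
next
  case (Step z s a \<zeta>)
  then have nz: "total_weight K \<zeta> \<noteq> 0" by simp
  show ?case unfolding total_weight_Step[OF nz] using nz Step.prems by simp
qed

lemma pmf_belief:
  fixes \<zeta> :: "('sl, 'sf::finite, 'al, 'af, 'zl) history"
  shows "admissible K \<zeta> \<Longrightarrow> pmf (belief K \<zeta>) y = follower_prob K \<zeta> y"
  by (rule pmf_belief_aux[OF admissible_total_weight])

lemma belief_Start: "belief K (Start s (x :: 'sf::finite pmf)) = x"
proof (rule pmf_eqI)
  fix y
  show "pmf (belief K (Start s x)) y = pmf x y"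
    unfolding pmf_belief[of K "Start s x", simplified] follower_prob_eq weight_Start
    using sum_pmf_eq_1[of UNIV x] by simp
qed

lemma belief_Step:
  fixes \<zeta> :: "('sl, 'sf::finite, 'al, 'af, 'zl) history"
  assumes "admissible K (Step z s a \<zeta>)"
  shows "belief K (Step z s a \<zeta>) = bayes K z s (leader \<zeta>) (belief K \<zeta>) a"
proof -
  have nz: "total_weight K \<zeta> \<noteq> 0"
    using assms by (intro admissible_total_weight) simp
  have "follower_prob K (Step z s a \<zeta>) y' =
      (\<Sum>y\<in>UNIV. pmf (K (leader \<zeta>, y) a) (z, s, y') * pmf (belief K \<zeta>) y)
        / sigma K z s (leader \<zeta>) (belief K \<zeta>) a" for y'
    unfolding follower_prob_eq total_weight_Step[OF nz] unfolding sum_weight_Step[OF nz]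
    using nz by simp
  then show ?thesis unfolding bayes_def belief_def[of K "Step z s a \<zeta>"] by presburger
qed

lemma next_prob_eq_sigma:
  fixes \<zeta> :: "('sl, 'sf::finite, 'al, 'af, 'zl) history"
  assumes "admissible K \<zeta>"
  shows "next_prob K \<zeta> a z s' = sigma K z s' (leader \<zeta>) (belief K \<zeta>) a"
proof -
  let ?L = "law K (init_leader \<zeta>) (init_prior \<zeta>) (acts \<zeta>)"
  let ?L' = "law K (init_leader \<zeta>) (init_prior \<zeta>) (a # acts \<zeta>)"
  have nz: "total_weight K \<zeta> \<noteq> 0" by (rule admissible_total_weight[OF assms])
  have past: "map_pmf (past \<circ> fst) ?L' = map_pmf fst ?L"
    by (simp add: map_bind_pmf map_pmf_comp case_prod_unfold comp_def map_pmf_def[symmetric])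
  have "\<P>(\<omega> in ?L'. past (fst \<omega>) = \<zeta>) = measure (map_pmf (past \<circ> fst) ?L') {\<zeta>}"
    by (simp add: vimage_def comp_def del: law.simps)
  also have "\<dots> = \<P>(\<omega> in ?L. fst \<omega> = \<zeta>)"
    unfolding past by (simp add: vimage_def)
  finally have den: "\<P>(\<omega> in ?L'. past (fst \<omega>) = \<zeta>) = total_weight K \<zeta>"
    by (simp only: prob_history)
  have "\<P>(\<omega> in ?L'. (obs (fst \<omega>) = z \<and> leader (fst \<omega>) = s') \<and> past (fst \<omega>) = \<zeta>)
      = \<P>(\<omega> in ?L'. fst \<omega> = Step z s' a \<zeta>)"
    by (rule measure_pmf.finite_measure_eq_AE) (auto simp: AE_measure_pmf_iff)
  also have "\<dots> = total_weight K (Step z s' a \<zeta>)"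
    using prob_history[of K "Step z s' a \<zeta>"] by simp
  finally show ?thesis
    unfolding next_prob_def cond_prob_def den total_weight_Step[OF nz] using nz by simp
qed

end

theory Submission
  imports Defs
begin

text \<open>
  Both halves rest on Bayes' rule in the form \<open>sigma \<cdot> bayes = (unnormalised posterior)\<close>, where the
  unnormalised posterior \<open>y' \<mapsto> \<Sum>y. P(z, s', y' | s, y, a) x(y)\<close> is linear in the belief \<open>x\<close>.

  Sufficiency. The value functions are the iterates \<open>u\<^sub>t = H\<^bsup>T+1-t\<^esup> 0\<close>.  In the recursion for
  \<open>v\<^sub>t(\<zeta>)\<close> the conditional law of the next observation and leader state is \<open>sigma\<close> at the current
  belief, and along a prolongation of positive probability the belief moves by \<open>bayes\<close>.  So if
  \<open>v\<^sub>t\<^sub>+\<^sub>1\<close> depends on the history only through (leader state, belief), the recursion for \<open>v\<^sub>t\<close> is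
  literally the one defining \<open>H\<close> (\<open>worst_case_value_eq_H_iterate\<close>); after a
  prolongation of probability zero the belief is arbitrary, but its weight is zero on both sides.  The iterates
  are bounded because \<open>sigma\<close> is a probability vector in \<open>(z, s')\<close> and the rewards take finitely
  many values (\<open>H_in_V\<close>).

  Piecewise linearity. If \<open>v(s', \<cdot>)\<close> selects at every belief one of finitely many
  linear functionals, then \<open>sigma \<cdot> v(s', bayes)\<close> is that functional applied to the unnormalised
  posterior: the normalising constant cancels, and what remains is linear in the prior belief
  (\<open>piecewise_linear_sigma_bayes\<close>).  The other operations in \<open>H\<close> are finite sums, scalar multiples,
  maxima and minima, all of which preserve piecewise linearity, because a finite maximum or minimum
  always selects one of its arguments.
\<close>

section \<open>Bayes' rule on beliefs\<close>

lemma sigma_nonneg: "0 \<le> sigma K z s' s x a"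
  unfolding sigma_def by (intro sum_nonneg mult_nonneg_nonneg) auto

lemma sum_sigma:
  fixes K :: "('sl::finite, 'sf::finite, 'al, 'af, 'zl::finite) kernel"
  shows "(\<Sum>z\<in>UNIV. \<Sum>s'\<in>UNIV. sigma K z s' s x a) = 1"
proof -
  have kernel: "(\<Sum>z\<in>UNIV. \<Sum>s'\<in>UNIV. \<Sum>y'\<in>UNIV. pmf (K (s, y) a) (z, s', y')) = 1" for y
    using sum_pmf_eq_1[of UNIV "K (s, y) a"]
    by (simp add: sum.cartesian_product case_prod_unfold)
  have "(\<Sum>z\<in>UNIV. \<Sum>s'\<in>UNIV. sigma K z s' s x a) =
      (\<Sum>z\<in>UNIV. \<Sum>s'\<in>UNIV. \<Sum>y\<in>UNIV. \<Sum>y'\<in>UNIV. pmf (K (s, y) a) (z, s', y') * pmf x y)"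
    unfolding sigma_def by (intro sum.cong refl sum.swap)
  also have "\<dots> = (\<Sum>z\<in>UNIV. \<Sum>y\<in>UNIV. \<Sum>s'\<in>UNIV. \<Sum>y'\<in>UNIV.
      pmf (K (s, y) a) (z, s', y') * pmf x y)"
    by (intro sum.cong refl sum.swap)
  also have "\<dots> = (\<Sum>y\<in>UNIV. \<Sum>z\<in>UNIV. \<Sum>s'\<in>UNIV. \<Sum>y'\<in>UNIV.
      pmf (K (s, y) a) (z, s', y') * pmf x y)"
    by (rule sum.swap)
  also have "\<dots> = (\<Sum>y\<in>UNIV. pmf x y)"
    by (simp add: kernel flip: sum_distrib_right)
  finally show ?thesis
    by (simp add: sum_pmf_eq_1)
qed

text \<open>
  In this division-free form Bayes' rule also covers \<open>sigma = 0\<close>: the right-hand side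
  consists of nonnegative numbers with sum \<open>sigma\<close>, so it vanishes whatever \<open>bayes\<close> is.
\<close>

lemma sigma_times_bayes:
  fixes K :: "('sl, 'sf::finite, 'al, 'af, 'zl) kernel"
  shows "sigma K z s' s x a * pmf (bayes K z s' s x a) y' =
    (\<Sum>y\<in>UNIV. pmf (K (s, y) a) (z, s', y') * pmf x y)"
proof -
  define w where "w y' = (\<Sum>y\<in>UNIV. pmf (K (s, y) a) (z, s', y') * pmf x y)" for y'
  have w_nonneg: "0 \<le> w y'" for y'
    unfolding w_def by (intro sum_nonneg mult_nonneg_nonneg) auto
  have sigma: "sigma K z s' s x a = sum w UNIV"
    by (simp add: sigma_def w_def)
  have "sum w UNIV * pmf (embed_pmf (\<lambda>y'. w y' / sum w UNIV)) y' = w y'"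
  proof (cases "sum w UNIV = 0")
    case True
    then show ?thesis
      using w_nonneg by (simp add: sum_nonneg_eq_0_iff)
  next
    case False
    then have "pmf (embed_pmf (\<lambda>y'. w y' / sum w UNIV)) y' = w y' / sum w UNIV"
      by (intro pmf_embed_pmf_finite)
        (auto simp: w_nonneg sum_nonneg simp flip: sum_divide_distrib)
    with False show ?thesis
      by simp
  qed
  then show ?thesis
    by (simp add: bayes_def sigma w_def)
qed

section \<open>The Bellman operator on bounded functions\<close>

definition action_value :: "('sl::finite, 'sf::finite, 'al, 'af, 'zl::finite) kernel
    \<Rightarrow> ('sl, 'sf, 'al, 'af) reward \<Rightarrow> real \<Rightarrow> ('sl \<times> 'sf pmf \<Rightarrow> real)
    \<Rightarrow> 'sl \<Rightarrow> 'al \<times> 'af \<Rightarrow> 'sf pmf \<Rightarrow> real" where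
  "action_value K r \<beta> v s a x =
     (\<Sum>y\<in>UNIV. pmf x y * r (s, y) a)
     + \<beta> * (\<Sum>z\<in>UNIV. \<Sum>s'\<in>UNIV. sigma K z s' s x a * v (s', bayes K z s' s x a))"

lemma H_eq_action_value:
  "H K r \<beta> v (s, x) = (MAX aL. MIN aF. action_value K r \<beta> v s (aL, aF) x)"
  by (simp add: H_def action_value_def)

lemma Max_range_witness:
  fixes f :: "'i::finite \<Rightarrow> real"
  shows "\<exists>i. (MAX i. f i) = f i"
  using Max_in[of "range f"] by (auto simp del: Max_in)

lemma Min_range_witness:
  fixes f :: "'i::finite \<Rightarrow> real"
  shows "\<exists>i. (MIN i. f i) = f i"
  using Min_in[of "range f"] by (auto simp del: Min_in)

text \<open>
  The immediate and the discounted future part are averages, against the belief and against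
  \<open>sigma\<close>, so the bounds on \<open>r\<close> and \<open>v\<close> carry over without any factor for the number of
  summands.
\<close>

lemma abs_action_value_le:
  assumes r: "\<And>s a. \<bar>r s a\<bar> \<le> R" and v: "\<And>p. \<bar>v p\<bar> \<le> B"
  shows "\<bar>action_value K r \<beta> v s a x\<bar> \<le> R + \<bar>\<beta>\<bar> * B"
proof -
  have "\<bar>\<Sum>y\<in>UNIV. pmf x y * r (s, y) a\<bar> \<le> (\<Sum>y\<in>UNIV. pmf x y * R)"
    by (rule order_trans[OF sum_abs])
      (auto intro!: sum_mono mult_left_mono r simp: abs_mult)
  also have "\<dots> = R"
    by (simp add: sum_pmf_eq_1 flip: sum_distrib_right)
  finally have immediate: "\<bar>\<Sum>y\<in>UNIV. pmf x y * r (s, y) a\<bar> \<le> R" .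
  let ?F = "\<Sum>z\<in>UNIV. \<Sum>s'\<in>UNIV. sigma K z s' s x a * v (s', bayes K z s' s x a)"
  have "\<bar>?F\<bar> \<le> (\<Sum>z\<in>UNIV. \<Sum>s'\<in>UNIV. sigma K z s' s x a * B)"
    by (rule order_trans[OF sum_abs], rule sum_mono, rule order_trans[OF sum_abs])
      (auto intro!: sum_mono mult_left_mono v simp: abs_mult sigma_nonneg)
  also have "\<dots> = B"
    by (simp add: sum_sigma flip: sum_distrib_right)
  finally have "\<bar>\<beta> * ?F\<bar> \<le> \<bar>\<beta>\<bar> * B"
    by (simp add: abs_mult mult_left_mono)
  with immediate show ?thesis
    unfolding action_value_def by linarith
qed

lemma H_in_V:
  fixes K :: "('sl::finite, 'sf::finite, 'al::finite, 'af::finite, 'zl::finite) kernel"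
  assumes "v \<in> V"
  shows "H K r \<beta> v \<in> V"
proof -
  obtain B where B: "\<And>p. \<bar>v p\<bar> \<le> B"
    using assms by (auto simp: V_def bounded_iff)
  have "finite (range (case_prod r))"
    by simp
  then obtain R where "\<forall>\<rho>\<in>range (case_prod r). norm \<rho> \<le> R"
    by (meson finite_imp_bounded bounded_iff)
  then have R: "\<And>s a. \<bar>r s a\<bar> \<le> R"
    by auto
  have "\<bar>H K r \<beta> v (s, x)\<bar> \<le> R + \<bar>\<beta>\<bar> * B" for s x
  proof -
    obtain aL where "H K r \<beta> v (s, x) = (MIN aF. action_value K r \<beta> v s (aL, aF) x)"
      unfolding H_eq_action_value
      using Max_range_witness[of "\<lambda>aL. MIN aF. action_value K r \<beta> v s (aL, aF) x"] by auto
    moreover obtain aF where "(MIN aF. action_value K r \<beta> v s (aL, aF) x)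
        = action_value K r \<beta> v s (aL, aF) x"
      using Min_range_witness[of "\<lambda>aF. action_value K r \<beta> v s (aL, aF) x"] by auto
    ultimately show ?thesis
      using abs_action_value_le[of r R v B] R B by simp
  qed
  then show ?thesis
    by (auto simp: V_def bounded_iff)
qed

lemma H_iterate_in_V:
  fixes K :: "('sl::finite, 'sf::finite, 'al::finite, 'af::finite, 'zl::finite) kernel"
  shows "(H K r \<beta> ^^ n) (\<lambda>_. 0) \<in> V"
proof (induction n)
  case 0
  have "bounded (range (\<lambda>_ :: 'sl \<times> 'sf pmf. 0 :: real))"
    by (auto simp: bounded_iff)
  then show ?case
    by (simp add: V_def)
next
  case (Suc n)
  then show ?case
    by (simp add: H_in_V)
qed

section \<open>Sufficiency of leader state and belief\<close>

text \<open>
  Backward induction on the number \<open>T + 1 - t\<close> of stages left.  The induction hypothesis speaks only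
  of admissible histories, so a prolongation with \<open>sigma = 0\<close> escapes it; there the weight in the
  recursion vanishes.
\<close>

lemma worst_case_value_eq_H_iterate:
  fixes K :: "('sl::finite, 'sf::finite, 'al::finite, 'af::finite, 'zl::finite) kernel"
  assumes "admissible K \<zeta>"
  shows "worst_case_value K r \<beta> T t \<zeta>
    = (H K r \<beta> ^^ (Suc T - t)) (\<lambda>_. 0) (leader \<zeta>, belief K \<zeta>)"
  using assms
proof (induction "Suc T - t" arbitrary: t \<zeta>)
  case 0
  then show ?case
    by (simp add: worst_case_value.simps)
next
  case (Suc n)
  define u where "u = (H K r \<beta> ^^ n) (\<lambda>_. 0)"
  from Suc.hyps(2) have t: "t \<le> T" and n: "n = Suc T - Suc t"
    by simp_all
  have future: "next_prob K \<zeta> a z s' * worst_case_value K r \<beta> T (Suc t) (Step z s' a \<zeta>) =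
      sigma K z s' (leader \<zeta>) (belief K \<zeta>) a
        * u (s', bayes K z s' (leader \<zeta>) (belief K \<zeta>) a)" for a z s'
  proof (cases "sigma K z s' (leader \<zeta>) (belief K \<zeta>) a = 0")
    case True
    then show ?thesis
      by (simp add: next_prob_eq_sigma[OF Suc.prems])
  next
    case False
    with Suc.prems have adm: "admissible K (Step z s' a \<zeta>)"
      by simp
    have "worst_case_value K r \<beta> T (Suc t) (Step z s' a \<zeta>)
        = u (s', belief K (Step z s' a \<zeta>))"
      using Suc.hyps(1)[OF n adm] n by (simp add: u_def)
    then show ?thesis
      by (simp add: next_prob_eq_sigma[OF Suc.prems] belief_Step[OF adm])
  qed
  have "worst_case_value K r \<beta> T t \<zeta> = H K r \<beta> u (leader \<zeta>, belief K \<zeta>)"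
    using t
    by (simp add: worst_case_value.simps[of K r \<beta> T t] future H_def mult.commute
        flip: pmf_belief[OF Suc.prems])
  then show ?case
    by (simp add: u_def flip: Suc.hyps(2))
qed

section \<open>Piecewise linearity\<close>

lemma piecewise_linear_linear:
  "piecewise_linear (\<lambda>x. \<Sum>y\<in>UNIV. pmf x y * c y)"
  unfolding piecewise_linear_def by (rule exI[of _ "{c}"]) simp

lemma piecewise_linear_cmult:
  assumes "piecewise_linear f"
  shows "piecewise_linear (\<lambda>x. c * f x)"
proof -
  obtain \<Gamma> where \<Gamma>: "finite \<Gamma>" "\<forall>x. \<exists>\<gamma>\<in>\<Gamma>. f x = (\<Sum>y\<in>UNIV. pmf x y * \<gamma> y)"
    using assms unfolding piecewise_linear_def by blast
  have "\<exists>\<delta>\<in>(\<lambda>\<gamma> y. c * \<gamma> y) ` \<Gamma>. c * f x = (\<Sum>y\<in>UNIV. pmf x y * \<delta> y)" for x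
    using \<Gamma>(2)[rule_format, of x] by (auto simp: sum_distrib_left mult.left_commute)
  with \<Gamma>(1) show ?thesis
    unfolding piecewise_linear_def by blast
qed

lemma piecewise_linear_add:
  assumes "piecewise_linear f" "piecewise_linear g"
  shows "piecewise_linear (\<lambda>x. f x + g x)"
proof -
  obtain \<Gamma> where \<Gamma>: "finite \<Gamma>" "\<forall>x. \<exists>\<gamma>\<in>\<Gamma>. f x = (\<Sum>y\<in>UNIV. pmf x y * \<gamma> y)"
    using assms(1) unfolding piecewise_linear_def by blast
  obtain \<Delta> where \<Delta>: "finite \<Delta>" "\<forall>x. \<exists>\<delta>\<in>\<Delta>. g x = (\<Sum>y\<in>UNIV. pmf x y * \<delta> y)"
    using assms(2) unfolding piecewise_linear_def by blast
  have "\<exists>\<eta>\<in>(\<lambda>(\<gamma>, \<delta>) y. \<gamma> y + \<delta> y) ` (\<Gamma> \<times> \<Delta>).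
      f x + g x = (\<Sum>y\<in>UNIV. pmf x y * \<eta> y)" for x
  proof -
    obtain \<gamma> \<delta> where "\<gamma> \<in> \<Gamma>" "f x = (\<Sum>y\<in>UNIV. pmf x y * \<gamma> y)"
        "\<delta> \<in> \<Delta>" "g x = (\<Sum>y\<in>UNIV. pmf x y * \<delta> y)"
      using \<Gamma>(2) \<Delta>(2) by metis
    then show ?thesis
      by (intro bexI[of _ "\<lambda>y. \<gamma> y + \<delta> y"]) (auto simp: distrib_left sum.distrib)
  qed
  moreover have "finite ((\<lambda>(\<gamma>, \<delta>) y. \<gamma> y + \<delta> y) ` (\<Gamma> \<times> \<Delta>))"
    using \<Gamma>(1) \<Delta>(1) by simp
  ultimately show ?thesis
    unfolding piecewise_linear_def by blast
qed

lemma piecewise_linear_sum: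
  assumes "\<And>i. i \<in> I \<Longrightarrow> piecewise_linear (f i)"
  shows "piecewise_linear (\<lambda>x. \<Sum>i\<in>I. f i x)"
  using assms
proof (induction I rule: infinite_finite_induct)
  case (insert i I)
  then show ?case
    by (simp add: piecewise_linear_add)
qed (use piecewise_linear_linear[of "\<lambda>_. 0"] in simp_all)

text \<open>Finite maxima and minima are the instances needed: each selects one of the functions.\<close>

lemma piecewise_linear_selection:
  fixes f :: "'i::finite \<Rightarrow> 'sf::finite pmf \<Rightarrow> real"
  assumes "\<And>i. piecewise_linear (f i)" and "\<And>x. \<exists>i. g x = f i x"
  shows "piecewise_linear g"
proof -
  obtain \<Gamma> where \<Gamma>: "\<And>i. finite (\<Gamma> i)"
      "\<And>i x. \<exists>\<gamma>\<in>\<Gamma> i. f i x = (\<Sum>y\<in>UNIV. pmf x y * \<gamma> y)"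
    using assms(1) unfolding piecewise_linear_def by metis
  have "\<exists>\<gamma>\<in>(\<Union>i. \<Gamma> i). g x = (\<Sum>y\<in>UNIV. pmf x y * \<gamma> y)" for x
    using assms(2)[of x] \<Gamma>(2) by fastforce
  moreover have "finite (\<Union>i. \<Gamma> i)"
    using \<Gamma>(1) by simp
  ultimately show ?thesis
    unfolding piecewise_linear_def by blast
qed

lemma piecewise_linear_Max:
  fixes f :: "'i::finite \<Rightarrow> 'sf::finite pmf \<Rightarrow> real"
  assumes "\<And>i. piecewise_linear (f i)"
  shows "piecewise_linear (\<lambda>x. MAX i. f i x)"
  by (rule piecewise_linear_selection[of f, OF assms]) (rule Max_range_witness)

lemma piecewise_linear_Min:
  fixes f :: "'i::finite \<Rightarrow> 'sf::finite pmf \<Rightarrow> real"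
  assumes "\<And>i. piecewise_linear (f i)"
  shows "piecewise_linear (\<lambda>x. MIN i. f i x)"
  by (rule piecewise_linear_selection[of f, OF assms]) (rule Min_range_witness)

text \<open>
  Although \<open>bayes\<close> is a rational function of \<open>x\<close>, the factor \<open>sigma\<close> is exactly its
  denominator.  A functional \<open>\<gamma>\<close> at the posterior pulls back to the functional
  \<open>y \<mapsto> \<Sum>y'. P(z, s', y' | s, y, a) \<gamma>(y')\<close> at the prior.
\<close>

lemma piecewise_linear_sigma_bayes:
  fixes K :: "('sl, 'sf::finite, 'al, 'af, 'zl) kernel"
  assumes "piecewise_linear f"
  shows "piecewise_linear (\<lambda>x. sigma K z s' s x a * f (bayes K z s' s x a))"
proof -
  obtain \<Gamma> where \<Gamma>: "finite \<Gamma>" "\<forall>x. \<exists>\<gamma>\<in>\<Gamma>. f x = (\<Sum>y\<in>UNIV. pmf x y * \<gamma> y)"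
    using assms unfolding piecewise_linear_def by blast
  define pull where "pull \<gamma> y = (\<Sum>y'\<in>UNIV. pmf (K (s, y) a) (z, s', y') * \<gamma> y')"
    for \<gamma> :: "'sf \<Rightarrow> real" and y
  have "\<exists>\<delta>\<in>pull ` \<Gamma>. sigma K z s' s x a * f (bayes K z s' s x a)
      = (\<Sum>y\<in>UNIV. pmf x y * \<delta> y)" for x
  proof -
    obtain \<gamma> where \<gamma>: "\<gamma> \<in> \<Gamma>"
        "f (bayes K z s' s x a) = (\<Sum>y'\<in>UNIV. pmf (bayes K z s' s x a) y' * \<gamma> y')"
      using \<Gamma>(2)[rule_format, of "bayes K z s' s x a"] by blast
    have "sigma K z s' s x a * f (bayes K z s' s x a)
        = (\<Sum>y'\<in>UNIV. (sigma K z s' s x a * pmf (bayes K z s' s x a) y') * \<gamma> y')"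
      by (simp add: \<gamma>(2) sum_distrib_left mult.assoc)
    also have "\<dots> = (\<Sum>y'\<in>UNIV. \<Sum>y\<in>UNIV. pmf (K (s, y) a) (z, s', y') * pmf x y * \<gamma> y')"
      by (simp add: sigma_times_bayes sum_distrib_right)
    also have "\<dots> = (\<Sum>y\<in>UNIV. \<Sum>y'\<in>UNIV. pmf (K (s, y) a) (z, s', y') * pmf x y * \<gamma> y')"
      by (rule sum.swap)
    also have "\<dots> = (\<Sum>y\<in>UNIV. pmf x y * pull \<gamma> y)"
      by (simp add: pull_def sum_distrib_left mult.assoc mult.left_commute)
    finally show ?thesis
      using \<gamma>(1) by blast
  qed
  moreover have "finite (pull ` \<Gamma>)"
    using \<Gamma>(1) by simp
  ultimately show ?thesis
    unfolding piecewise_linear_def by blast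
qed

lemma piecewise_linear_H:
  fixes K :: "('sl::finite, 'sf::finite, 'al::finite, 'af::finite, 'zl::finite) kernel"
  assumes "\<And>s. piecewise_linear (\<lambda>x. v (s, x))"
  shows "piecewise_linear (\<lambda>x. H K r \<beta> v (s, x))"
proof -
  have "piecewise_linear (\<lambda>x. sigma K z s' s x a * v (s', bayes K z s' s x a))" for z s' a
    by (rule piecewise_linear_sigma_bayes[OF assms])
  then have "piecewise_linear (action_value K r \<beta> v s a)" for a
    unfolding action_value_def[abs_def]
    by (intro piecewise_linear_add piecewise_linear_linear piecewise_linear_cmult
        piecewise_linear_sum)
  then show ?thesis
    unfolding H_eq_action_value by (intro piecewise_linear_Max piecewise_linear_Min)
qed

section \<open>The sufficient statistic and the structure of the value functions\<close>

theorem proposition1: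
  fixes K :: "('sl::finite, 'sf::finite, 'al::finite, 'af::finite, 'zl::finite) kernel"
    and r :: "('sl, 'sf, 'al, 'af) reward"
    and \<beta> :: real
    and T :: nat
  assumes "0 \<le> \<beta>"
  shows "(\<exists>u :: nat \<Rightarrow> 'sl \<times> 'sf pmf \<Rightarrow> real.
            (\<forall>t. u t \<in> V) \<and> u (Suc T) = (\<lambda>_. 0) \<and>
            (\<forall>t\<le>T. \<forall>\<zeta>. admissible K \<zeta> \<and> epoch \<zeta> = t \<longrightarrow>
               worst_case_value K r \<beta> T t \<zeta> = u t (leader \<zeta>, belief K \<zeta>) \<and>
               u t (leader \<zeta>, belief K \<zeta>) = H K r \<beta> (u (Suc t)) (leader \<zeta>, belief K \<zeta>)))
       \<and> (\<forall>v\<in>V. (\<forall>s. piecewise_linear (\<lambda>x. v (s, x)))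
              \<longrightarrow> (\<forall>s. piecewise_linear (\<lambda>x. H K r \<beta> v (s, x))))"
proof (intro conjI ballI impI allI)
  define u where "u t = (H K r \<beta> ^^ (Suc T - t)) (\<lambda>_. 0)" for t
  have "u t = H K r \<beta> (u (Suc t))" if "t \<le> T" for t
    using that by (simp add: u_def Suc_diff_le)
  then show "\<exists>u :: nat \<Rightarrow> 'sl \<times> 'sf pmf \<Rightarrow> real.
            (\<forall>t. u t \<in> V) \<and> u (Suc T) = (\<lambda>_. 0) \<and>
            (\<forall>t\<le>T. \<forall>\<zeta>. admissible K \<zeta> \<and> epoch \<zeta> = t \<longrightarrow>
               worst_case_value K r \<beta> T t \<zeta> = u t (leader \<zeta>, belief K \<zeta>) \<and>
               u t (leader \<zeta>, belief K \<zeta>) = H K r \<beta> (u (Suc t)) (leader \<zeta>, belief K \<zeta>))"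
    by (intro exI[of _ u]) (auto simp: H_iterate_in_V worst_case_value_eq_H_iterate u_def
        simp del: funpow.simps)
qed (simp add: piecewise_linear_H)

end
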